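(* Let $D$ be a division ring with center $F$ over which Kaplansky's Theorem holds, i.e., for every $m \in \mathbb{N}$, every semigroup in $M_m(D)$ all of whose members are of the form $cI + N$, with $c \in F$ and $N \in M_m(D)$ nilpotent, is triangularizable. Let $n \in \mathbb{N}$, let $\mathcal{T}$ be a triangularizable set of matrices in $M_n(D)$ with inner-eigenvalues in $F$, let $\mathcal{N}$ be the set of all nilpotent matrices in $M_n(D)$, and let $\mathcal{T}'$ be the commutant of $\mathcal{T}$. Let $\mathcal{S}$ be a semigroup in $M_n(D)$ such that every member of $\mathcal{S}$ is of the form $T + N$ with $T \in \mathcal{T}$ and $N \in \mathcal{T}' \cap \mathcal{N}$. Then the semigroup $\mathcal{S}$ is triangularizable.
   Context: $M_n(D)$ is the ring of all $n \times n$ matrices over $D$, whose members are viewed as linear transformations acting on the left of $D^n$, the right vector space over $D$ of $n \times 1$ column vectors. A semigroup in $M_n(D)$ is a set of matrices closed under multiplication. The commutant of a collection $\mathcal{C} \subseteq M_n(D)$ is $\mathcal{C}' = \{A \in M_n(D) : AB = BA \ \text{for all}\ B \in \mathcal{C}\}$. A collection $\mathcal{C} \subseteq M_n(D)$ is triangularizable if there are subspaces $\{0\} = \mathcal{V}_0 \subseteq \mathcal{V}_1 \subseteq \cdots \subseteq \mathcal{V}_n = D^n$ such that $\dim \mathcal{V}_j = j$ and each $\mathcal{V}_j$ is invariant under every member of $\mathcal{C}$ (the same chain for all members). For a triangularizable linear transformation $T$, an element $\lambda \in D$ is an inner eigenvalue of $T$ relative to a triangularizing basis $\mathcal{B}$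 for $T$ if $\lambda$ appears on the main diagonal of the (upper triangular) matrix of $T$ with respect to $\mathcal{B}$. A triangularizable set $\mathcal{T}$ has inner-eigenvalues in $F$ if, for every $T \in \mathcal{T}$, all inner eigenvalues of $T$ relative to a triangularizing basis lie in $F$ (if this holds for one triangularizing basis of $T$, it holds for all of them). *)

theory Defs
  imports "Jordan_Normal_Form.Matrix"
begin

text \<open>The division ring is the whole type \<open>'a :: division_ring\<close>.  Matrices are those of
  Jordan_Normal_Form, whose product and action \<open>*\<^sub>v\<close> on column vectors multiply entries of the
  matrix on the left, so they make sense without commutativity.  The library's scalar
  multiplication of vectors is the left one; \<open>D\<^sup>n\<close> is a \<^emph>\<open>right\<close> vector space here, so the
  linear algebra of right subspaces is set up below.\<close>

definition ring_center :: "'a::division_ring set" where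
  "ring_center = {c. \<forall>x. c * x = x * c}"

definition right_smult :: "'a::division_ring vec \<Rightarrow> 'a \<Rightarrow> 'a vec" where
  "right_smult v a = map_vec (\<lambda>x. x * a) v"

definition right_subspace :: "nat \<Rightarrow> 'a::division_ring vec set \<Rightarrow> bool" where
  "right_subspace n V \<longleftrightarrow>
     V \<subseteq> carrier_vec n \<and> 0\<^sub>v n \<in> V \<and> (\<forall>v\<in>V. \<forall>w\<in>V. v + w \<in> V) \<and>
     (\<forall>v\<in>V. \<forall>a. right_smult v a \<in> V)"

text \<open>The matrix with columns \<open>bs\<close>, applied to the coefficient vector \<open>c\<close>, is the right linear
  combination \<open>b\<^sub>0 c\<^sub>0 + b\<^sub>1 c\<^sub>1 + \<dots>\<close> of the vectors in the list \<open>bs\<close>.\<close>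

definition right_lincomb :: "nat \<Rightarrow> 'a::division_ring vec list \<Rightarrow> 'a vec \<Rightarrow> 'a vec" where
  "right_lincomb n bs c = mat_of_cols n bs *\<^sub>v c"

definition right_basis :: "nat \<Rightarrow> 'a::division_ring vec set \<Rightarrow> 'a vec list \<Rightarrow> bool" where
  "right_basis n V bs \<longleftrightarrow>
     set bs \<subseteq> carrier_vec n \<and>
     (\<forall>c\<in>carrier_vec (length bs).
        right_lincomb n bs c = 0\<^sub>v n \<longrightarrow> c = 0\<^sub>v (length bs)) \<and>
     right_lincomb n bs ` carrier_vec (length bs) = V"

definition has_right_dim :: "nat \<Rightarrow> 'a::division_ring vec set \<Rightarrow> nat \<Rightarrow> bool" where
  "has_right_dim n V d \<longleftrightarrow> (\<exists>bs. right_basis n V bs \<and> length bs = d)"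

definition triangularizable :: "nat \<Rightarrow> 'a::division_ring mat set \<Rightarrow> bool" where
  "triangularizable n C \<longleftrightarrow>
     (\<exists>V. V 0 = {0\<^sub>v n} \<and> V n = carrier_vec n \<and>
          (\<forall>j<n. V j \<subseteq> V (Suc j)) \<and>
          (\<forall>j\<le>n. right_subspace n (V j) \<and> has_right_dim n (V j) j) \<and>
          (\<forall>A\<in>C. \<forall>j\<le>n. \<forall>v\<in>V j. A *\<^sub>v v \<in> V j))"

definition mat_semigroup :: "nat \<Rightarrow> 'a::division_ring mat set \<Rightarrow> bool" where
  "mat_semigroup n S \<longleftrightarrow> S \<subseteq> carrier_mat n n \<and> (\<forall>A\<in>S. \<forall>B\<in>S. A * B \<in> S)"

definition nilpotent_mats :: "nat \<Rightarrow> 'a::division_ring mat set" where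
  "nilpotent_mats n = {N \<in> carrier_mat n n. \<exists>k. N ^\<^sub>m k = 0\<^sub>m n n}"

definition commutant :: "nat \<Rightarrow> 'a::division_ring mat set \<Rightarrow> 'a mat set" where
  "commutant n C = {A \<in> carrier_mat n n. \<forall>B\<in>C. A * B = B * A}"

text \<open>\<open>M\<close> is the matrix of \<open>T\<close> with respect to the basis \<open>bs\<close> of \<open>D\<^sup>n\<close>: its column \<open>j\<close> holds the
  right coordinates of \<open>T b\<^sub>j\<close>.\<close>

definition is_matrix_wrt ::
  "nat \<Rightarrow> 'a::division_ring vec list \<Rightarrow> 'a mat \<Rightarrow> 'a mat \<Rightarrow> bool" where
  "is_matrix_wrt n bs T M \<longleftrightarrow>
     M \<in> carrier_mat n n \<and> (\<forall>j<n. T *\<^sub>v (bs ! j) = right_lincomb n bs (col M j))"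

definition triangularizing_basis ::
  "nat \<Rightarrow> 'a::division_ring mat \<Rightarrow> 'a vec list \<Rightarrow> bool" where
  "triangularizing_basis n T bs \<longleftrightarrow>
     right_basis n (carrier_vec n) bs \<and> length bs = n \<and>
     (\<exists>M. is_matrix_wrt n bs T M \<and> upper_triangular M)"

definition inner_eigenvalues ::
  "nat \<Rightarrow> 'a::division_ring mat \<Rightarrow> 'a vec list \<Rightarrow> 'a set" where
  "inner_eigenvalues n T bs = {l. \<exists>M. is_matrix_wrt n bs T M \<and> l \<in> set (diag_mat M)}"

text \<open>Up to conjugation the inner eigenvalues do not depend on the triangularizing basis, so for
  central values it is immaterial whether one or all triangularizing bases are considered; the
  formally weaker existential form is used.\<close>

definition has_inner_eigenvalues_in ::
  "nat \<Rightarrow> 'a::division_ring mat set \<Rightarrow> 'a set \<Rightarrow> bool" where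
  "has_inner_eigenvalues_in n Ts F \<longleftrightarrow>
     (\<forall>T\<in>Ts. \<exists>bs. triangularizing_basis n T bs \<and> inner_eigenvalues n T bs \<subseteq> F)"

text \<open>The assertion that Kaplansky's theorem holds over the division ring \<open>'a\<close>.\<close>

definition Kaplansky_theorem_over :: "'a::division_ring itself \<Rightarrow> bool" where
  "Kaplansky_theorem_over _ \<longleftrightarrow>
     (\<forall>m. \<forall>S :: 'a mat set.
        mat_semigroup m S \<longrightarrow>
        (\<forall>A\<in>S. \<exists>c\<in>ring_center. \<exists>N\<in>nilpotent_mats m. A = c \<cdot>\<^sub>m 1\<^sub>m m + N) \<longrightarrow>
        triangularizable m S)"

end

theory Submission
  imports Defs
begin

text \<open>Let \<open>W\<close> be a proper right subspace invariant under \<open>Ts\<close> and its commutant, and take the first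
  member \<open>V\<^sub>j\<close> of a triangularizing chain for \<open>Ts\<close> not contained in \<open>W\<close>.  A vector
  \<open>v \<in> V\<^sub>j - W\<close> is, modulo \<open>W\<close>, a joint eigenvector of \<open>Ts\<close>, with eigenvalues \<open>\<lambda>\<^sub>T\<close>
  that are inner eigenvalues and hence central.  The set \<open>W'\<close> of all joint eigenvectors modulo
  \<open>W\<close> for these \<open>\<lambda>\<^sub>T\<close> is then a strictly larger right subspace, again invariant under \<open>Ts\<close> and its
  commutant, and on \<open>W' / W\<close> a member \<open>T + N\<close> of the semigroup acts as the central scalar
  \<open>\<lambda>\<^sub>T\<close> plus a nilpotent.  Kaplansky's theorem triangularizes the action on \<open>W' / W\<close>; lifting the
  resulting chains through the filtration obtained by repeating this gives the theorem.\<close>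

section \<open>Linear algebra of right subspaces\<close>

lemma right_smult_simps [simp]:
  "dim_vec (right_smult v a) = dim_vec v"
  "i < dim_vec v \<Longrightarrow> right_smult v a $ i = v $ i * a"
  "v \<in> carrier_vec n \<Longrightarrow> right_smult v a \<in> carrier_vec n"
  "right_smult (0\<^sub>v n) a = 0\<^sub>v n"
  by (auto simp: right_smult_def)

lemma right_smult_right_smult: "right_smult (right_smult v a) b = right_smult v (a * b)"
  by (intro eq_vecI) (auto simp: mult.assoc)

lemma right_smult_one [simp]: "right_smult v 1 = v"
  by (intro eq_vecI) auto

lemma right_smult_add:
  "v \<in> carrier_vec n \<Longrightarrow> w \<in> carrier_vec n \<Longrightarrow>
    right_smult (v + w) a = right_smult v a + right_smult w a"
  by (intro eq_vecI) (auto simp: algebra_simps)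

lemma mult_mat_vec_right_smult:
  assumes "A \<in> carrier_mat m n" "v \<in> carrier_vec n"
  shows "A *\<^sub>v right_smult v a = right_smult (A *\<^sub>v v) a"
  using assms by (intro eq_vecI) (auto simp: scalar_prod_def sum_distrib_right mult.assoc)

text \<open>The matrix \<open>c I\<close> multiplies entries on the left, whereas subspaces are
  closed under scalars on the right. Centrality of \<open>c\<close> makes the two agree, which ties
  the form \<open>c I + N\<close> in Kaplansky's theorem to right scaling of vectors.\<close>

lemma central_smult_one_mult_vec:
  assumes "c \<in> ring_center" "v \<in> carrier_vec n"
  shows "(c \<cdot>\<^sub>m 1\<^sub>m n) *\<^sub>v v = right_smult v c"
proof -
  have "(c \<cdot>\<^sub>m 1\<^sub>m n) *\<^sub>v v = c \<cdot>\<^sub>v v"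
    using assms by (intro eq_vecI) (auto simp: scalar_prod_def sum_distrib_left[symmetric] mult.assoc sum.delta if_distrib if_distribR cong: if_cong)
  also have "\<dots> = right_smult v c"
    using assms by (intro eq_vecI) (auto simp: ring_center_def)
  finally show ?thesis .
qed

lemma right_subspaceD:
  assumes "right_subspace n V"
  shows "V \<subseteq> carrier_vec n" "0\<^sub>v n \<in> V"
    "v \<in> V \<Longrightarrow> w \<in> V \<Longrightarrow> v + w \<in> V" "v \<in> V \<Longrightarrow> right_smult v a \<in> V"
  using assms by (auto simp: right_subspace_def)

lemma right_subspace_minus:
  assumes "right_subspace n V" "v \<in> V" "w \<in> V"
  shows "v - w \<in> V"
proof -
  have "v - w = v + right_smult w (-1)"
    using right_subspaceD(1)[OF assms(1)] assms(2,3) by (intro eq_vecI) auto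
  then show ?thesis using assms right_subspaceD by metis
qed

lemma right_subspace_smult_cancel:
  assumes "right_subspace n V" "right_smult v a \<in> V" "a \<noteq> 0"
  shows "v \<in> V"
  using right_subspaceD(4)[OF assms(1,2), of "inverse a"] assms(3)
  by (simp add: right_smult_right_smult)

section \<open>Right linear combinations of finite lists of vectors\<close>

lemma right_lincomb_carrier [simp]: "right_lincomb n bs c \<in> carrier_vec n"
  unfolding right_lincomb_def
  by (intro carrier_vecI) simp

lemma right_lincomb_Nil [simp]: "c \<in> carrier_vec 0 \<Longrightarrow> right_lincomb n [] c = 0\<^sub>v n"
  unfolding right_lincomb_def by (intro eq_vecI) (auto simp: scalar_prod_def mat_of_cols_def)

lemma right_lincomb_zero [simp]: "right_lincomb n bs (0\<^sub>v (length bs)) = 0\<^sub>v n"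
  unfolding right_lincomb_def by (intro eq_vecI) (auto simp: scalar_prod_def)

lemma right_lincomb_add:
  "c \<in> carrier_vec (length bs) \<Longrightarrow> d \<in> carrier_vec (length bs) \<Longrightarrow>
    right_lincomb n bs (c + d) = right_lincomb n bs c + right_lincomb n bs d"
  unfolding right_lincomb_def by (rule mult_add_distrib_mat_vec[of _ n]) auto

lemma right_lincomb_diff:
  "c \<in> carrier_vec (length bs) \<Longrightarrow> d \<in> carrier_vec (length bs) \<Longrightarrow>
    right_lincomb n bs (c - d) = right_lincomb n bs c - right_lincomb n bs d"
  unfolding right_lincomb_def by (rule mult_minus_distrib_mat_vec[of _ n]) auto

lemma right_lincomb_right_smult:
  "c \<in> carrier_vec (length bs) \<Longrightarrow>
    right_lincomb n bs (right_smult c a) = right_smult (right_lincomb n bs c) a"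
  unfolding right_lincomb_def by (rule mult_mat_vec_right_smult[of _ n]) auto

lemma right_lincomb_append:
  assumes "c \<in> carrier_vec (length bs)" "d \<in> carrier_vec (length cs)"
  shows "right_lincomb n (bs @ cs) (c @\<^sub>v d) = right_lincomb n bs c + right_lincomb n cs d"
proof -
  let ?f = "\<lambda>i j. (bs @ cs) ! j $ i * (c @\<^sub>v d) $ j"
  show ?thesis
  proof (intro eq_vecI)
    fix i assume "i < dim_vec (right_lincomb n bs c + right_lincomb n cs d)"
    then have i: "i < n" by (simp add: right_lincomb_def)
    have "right_lincomb n (bs @ cs) (c @\<^sub>v d) $ i = (\<Sum>j = 0..<length bs + length cs. ?f i j)"
      using i assms by (simp add: right_lincomb_def scalar_prod_def mat_of_cols_def)
    also have "\<dots> = (\<Sum>j = 0..<length bs. ?f i j) + (\<Sum>j = 0..<length cs. ?f i (j + length bs))"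
      using sum.atLeastLessThan_concat[of 0 "length bs" "length bs + length cs" "?f i"]
        sum.shift_bounds_nat_ivl[of "?f i" 0 "length bs" "length cs"]
      by (simp add: add.commute)
    also have "\<dots> = (right_lincomb n bs c + right_lincomb n cs d) $ i"
      using i assms by (simp add: right_lincomb_def scalar_prod_def mat_of_cols_def nth_append)
    finally show "right_lincomb n (bs @ cs) (c @\<^sub>v d) $ i =
      (right_lincomb n bs c + right_lincomb n cs d) $ i" .
  qed (simp add: right_lincomb_def)
qed

lemma carrier_vec_append_cases:
  assumes "c \<in> carrier_vec (l + m)"
  obtains c1 c2 where "c1 \<in> carrier_vec l" "c2 \<in> carrier_vec m" "c = c1 @\<^sub>v c2"
  using vec_first_last_append[OF assms] vec_first_carrier vec_last_carrier by metis

lemma right_lincomb_singleton: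
  assumes "v \<in> carrier_vec n" "c \<in> carrier_vec 1"
  shows "right_lincomb n [v] c = right_smult v (c $ 0)"
  using assms by (intro eq_vecI) (auto simp: right_lincomb_def scalar_prod_def mat_of_cols_def)

lemma right_lincomb_in_subspace:
  assumes V: "right_subspace n V" and "set bs \<subseteq> V" "c \<in> carrier_vec (length bs)"
  shows "right_lincomb n bs c \<in> V"
  using assms(2,3)
proof (induction bs arbitrary: c)
  case Nil
  then show ?case using right_subspaceD(2)[OF V] by simp
next
  case (Cons b bs)
  from Cons.prems have "c \<in> carrier_vec (1 + length bs)" by simp
  then obtain c1 c2 where c: "c1 \<in> carrier_vec 1" "c2 \<in> carrier_vec (length bs)" "c = c1 @\<^sub>v c2"
    by (rule carrier_vec_append_cases)
  have b: "b \<in> V" "b \<in> carrier_vec n" using Cons.prems right_subspaceD(1)[OF V] by auto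
  have "right_lincomb n (b # bs) c = right_smult b (c1 $ 0) + right_lincomb n bs c2"
    using right_lincomb_append[of c1 "[b]" c2 bs n] right_lincomb_singleton[OF b(2) c(1)] c by simp
  then show ?case using Cons b c right_subspaceD[OF V] by auto
qed

text \<open>With \<open>B\<close> and \<open>X\<close> the matrices whose columns are
  \<open>bs\<close> and \<open>xs\<close>, this is associativity,
  \<open>(B X) c = B (X c)\<close>.\<close>

lemma right_lincomb_right_lincomb:
  assumes "set xs \<subseteq> carrier_vec (length bs)" "c \<in> carrier_vec (length xs)"
  shows "right_lincomb n (map (right_lincomb n bs) xs) c
       = right_lincomb n bs (right_lincomb (length bs) xs c)"
proof -
  have "mat_of_cols n (map (right_lincomb n bs) xs) = mat_of_cols n bs * mat_of_cols (length bs) xs"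
  proof (intro eq_matI)
    fix i j assume "i < dim_row (mat_of_cols n bs * mat_of_cols (length bs) xs)"
      "j < dim_col (mat_of_cols n bs * mat_of_cols (length bs) xs)"
    then have ij: "i < n" "j < length xs" by auto
    then have "xs ! j \<in> carrier_vec (length bs)" using assms by auto
    then show "mat_of_cols n (map (right_lincomb n bs) xs) $$ (i, j)
       = (mat_of_cols n bs * mat_of_cols (length bs) xs) $$ (i, j)"
      using ij by (simp add: mat_of_cols_index right_lincomb_def)
  qed auto
  then show ?thesis
    using assms unfolding right_lincomb_def
    by (simp add: assoc_mult_mat_vec[of _ n "length bs" _ "length xs"])
qed

section \<open>Linear systems over a division ring, dimension, and bases modulo a subspace\<close>

text \<open>Gaussian elimination, by induction on the set of equations. Unknowns stand to the right
  of the coefficients, so row operations multiply on the left and commutativity never enters. A new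
  equation \<open>k\<close> either vanishes on \<open>J\<close> or has a pivot that eliminates one
  unknown.\<close>

lemma homogeneous_system_nontrivial_solution:
  fixes f :: "'i \<Rightarrow> 'j \<Rightarrow> 'a::division_ring"
  assumes "finite I" "finite J" "card I < card J"
  shows "\<exists>c. (\<exists>j\<in>J. c j \<noteq> 0) \<and> (\<forall>i\<in>I. (\<Sum>j\<in>J. f i j * c j) = 0)"
  using assms
proof (induction I arbitrary: J f rule: finite_induct)
  case empty
  then have "J \<noteq> {}" by auto
  then show ?case by (intro exI[of _ "\<lambda>_. 1"]) auto
next
  case (insert k I)
  show ?case
  proof (cases "\<forall>j\<in>J. f k j = 0")
    case True
    have "card I < card J" using insert by simp
    from insert.IH[OF insert.prems(1) this, of f] True show ?thesis by auto
  next
    case False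
    then obtain p where p: "p \<in> J" "f k p \<noteq> 0" by auto
    let ?J = "J - {p}"
    have "finite ?J" "card I < card ?J" using insert p by auto
    \<comment> \<open>Row \<open>i\<close> minus a left multiple of row \<open>k\<close>, chosen so
      that the coefficient of the unknown \<open>p\<close> becomes zero.\<close>
    from insert.IH[OF this, of "\<lambda>i j. f i j - f i p * inverse (f k p) * f k j"]
    obtain c where c: "\<exists>j\<in>?J. c j \<noteq> 0"
      "\<forall>i\<in>I. (\<Sum>j\<in>?J. (f i j - f i p * inverse (f k p) * f k j) * c j) = 0" by blast
    define s where "s = (\<Sum>j\<in>?J. f k j * c j)"
    \<comment> \<open>The value at \<open>p\<close> is the one that solves equation
      \<open>k\<close>, given the other unknowns.\<close>
    define c' where "c' = c(p := - inverse (f k p) * s)"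
    have *: "(\<Sum>j\<in>J. f i j * c' j) = - f i p * inverse (f k p) * s + (\<Sum>j\<in>?J. f i j * c j)" for i
    proof -
      have "(\<Sum>j\<in>J. f i j * c' j) = f i p * c' p + (\<Sum>j\<in>?J. f i j * c' j)"
        by (rule sum.remove) (use insert p in auto)
      also have "(\<Sum>j\<in>?J. f i j * c' j) = (\<Sum>j\<in>?J. f i j * c j)"
        by (rule sum.cong) (auto simp: c'_def)
      finally show ?thesis by (simp add: c'_def mult.assoc)
    qed
    have "(\<Sum>j\<in>J. f i j * c' j) = 0" if "i \<in> insert k I" for i
    proof (cases "i = k")
      case True
      then show ?thesis using p unfolding * by (simp add: s_def)
    next
      case False
      then have "(\<Sum>j\<in>?J. (f i j - f i p * inverse (f k p) * f k j) * c j) = 0"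
        using c that by auto
      then have "(\<Sum>j\<in>?J. f i j * c j) = f i p * inverse (f k p) * s"
        by (simp add: s_def sum_distrib_left left_diff_distrib sum_subtractf mult.assoc)
      then show ?thesis unfolding * by simp
    qed
    moreover have "\<exists>j\<in>J. c' j \<noteq> 0" using c(1) by (auto simp: c'_def)
    ultimately show ?thesis by blast
  qed
qed

lemma wide_right_lincomb_kernel:
  assumes "m < length xs"
  obtains c where "c \<in> carrier_vec (length xs)" "c \<noteq> 0\<^sub>v (length xs)" "right_lincomb m xs c = 0\<^sub>v m"
proof -
  from homogeneous_system_nontrivial_solution[of "{0..<m}" "{0..<length xs}" "\<lambda>i j. xs ! j $ i"] assms
  obtain c where c: "\<exists>j\<in>{0..<length xs}. c j \<noteq> 0"
    "\<forall>i\<in>{0..<m}. (\<Sum>j\<in>{0..<length xs}. xs ! j $ i * c j) = 0" by auto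
  show thesis
  proof
    show "vec (length xs) c \<noteq> 0\<^sub>v (length xs)"
      using c(1) by (metis atLeastLessThan_iff index_vec index_zero_vec(1))
    show "right_lincomb m xs (vec (length xs) c) = 0\<^sub>v m"
      using c(2) by (intro eq_vecI) (auto simp: right_lincomb_def scalar_prod_def mat_of_cols_def)
  qed auto
qed

text \<open>Independence of the classes of \<open>us\<close> in the quotient of the column space by
  \<open>W\<close>, phrased without forming a quotient. For \<open>W\<close> the zero subspace it is
  ordinary independence.\<close>

definition right_independent_mod ::
  "nat \<Rightarrow> 'a::division_ring vec set \<Rightarrow> 'a vec list \<Rightarrow> bool" where
  "right_independent_mod n W us \<longleftrightarrow>
     (\<forall>d\<in>carrier_vec (length us). right_lincomb n us d \<in> W \<longrightarrow> d = 0\<^sub>v (length us))"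

lemma right_basisD:
  assumes "right_basis n V bs"
  shows "set bs \<subseteq> carrier_vec n" "right_independent_mod n {0\<^sub>v n} bs"
    "right_lincomb n bs ` carrier_vec (length bs) = V"
  using assms by (auto simp: right_basis_def right_independent_mod_def)

text \<open>The coordinates of \<open>cs\<close> in a basis of size \<open>k\<close> are the columns
  of a matrix with \<open>k\<close> rows. If there were more columns than rows, a nonzero kernel
  vector would be a dependence among \<open>cs\<close>.\<close>

lemma length_le_right_dim:
  assumes dim: "has_right_dim n V k" and V: "set cs \<subseteq> V"
    and ind: "right_independent_mod n {0\<^sub>v n} cs"
  shows "length cs \<le> k"
proof (rule ccontr)
  assume "\<not> length cs \<le> k"
  from dim obtain bs where bs: "right_basis n V bs" "length bs = k"
    by (auto simp: has_right_dim_def)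
  have "\<forall>x\<in>V. \<exists>d. d \<in> carrier_vec k \<and> right_lincomb n bs d = x"
    using right_basisD(3)[OF bs(1)] bs(2) by auto
  then obtain f where f: "\<And>x. x \<in> V \<Longrightarrow> f x \<in> carrier_vec k"
    "\<And>x. x \<in> V \<Longrightarrow> right_lincomb n bs (f x) = x" by metis
  have cs: "cs = map (right_lincomb n bs) (map f cs)"
    unfolding map_map by (rule map_idI[symmetric]) (use f V in auto)
  have "k < length (map f cs)" using \<open>\<not> length cs \<le> k\<close> by simp
  then obtain c where c: "c \<in> carrier_vec (length (map f cs))" "c \<noteq> 0\<^sub>v (length (map f cs))"
    "right_lincomb k (map f cs) c = 0\<^sub>v k"
    by (rule wide_right_lincomb_kernel)
  have "right_lincomb n cs c = right_lincomb n bs (right_lincomb (length bs) (map f cs) c)"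
    by (subst cs, rule right_lincomb_right_lincomb) (use f V bs c in auto)
  also have "\<dots> = 0\<^sub>v n" using c bs by auto
  finally show False using ind c by (auto simp: right_independent_mod_def)
qed

lemma has_right_dim_carrier_vec: "has_right_dim n (carrier_vec n :: 'a::division_ring vec set) n"
proof -
  have "mat_of_cols n (unit_vecs n) = (1\<^sub>m n :: 'a mat)"
    by (intro eq_matI) (auto simp: mat_of_cols_index unit_vecs_def)
  then have "right_lincomb n (unit_vecs n) c = (c :: 'a vec)" if "c \<in> carrier_vec n" for c
    using that by (simp add: right_lincomb_def)
  then have "right_basis n (carrier_vec n :: 'a vec set) (unit_vecs n)"
    by (auto simp: right_basis_def unit_vecs_def)
  then show ?thesis by (auto simp: has_right_dim_def unit_vecs_def)
qed

lemma has_right_dim_zero: "has_right_dim n {0\<^sub>v n :: 'a::division_ring vec} 0"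
  by (auto simp: has_right_dim_def right_basis_def intro!: exI[of _ "[]"] image_eqI[of _ _ "0\<^sub>v 0"])

lemma right_basis_subset:
  assumes "right_basis n V bs"
  shows "set bs \<subseteq> V"
proof
  fix b assume "b \<in> set bs"
  then obtain i where i: "i < length bs" "b = bs ! i" by (auto simp: in_set_conv_nth)
  have b: "b \<in> carrier_vec n" using right_basisD(1)[OF assms] \<open>b \<in> set bs\<close> by auto
  then have "right_lincomb n bs (unit_vec (length bs) i) = b"
    using i by (intro eq_vecI) (auto simp: right_lincomb_def mat_of_cols_index)
  then show "b \<in> V" using right_basisD(3)[OF assms] by force
qed

lemma has_right_dim_mono:
  assumes "has_right_dim n V k" "has_right_dim n W l" "V \<subseteq> W"
  shows "k \<le> l"
proof -
  from assms(1) obtain bs where bs: "right_basis n V bs" "length bs = k"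
    by (auto simp: has_right_dim_def)
  show ?thesis
    using length_le_right_dim[OF assms(2), of bs] right_basis_subset[OF bs(1)]
      assms(3) right_basisD(2)[OF bs(1)] bs(2) by auto
qed

text \<open>If \<open>v\<close> occurred with a nonzero coefficient in a combination lying in
  \<open>W\<close>, dividing by that coefficient on the right would express \<open>v\<close> by
  \<open>W\<close> and \<open>us\<close>.\<close>

lemma right_independent_mod_snoc:
  assumes W: "right_subspace n W" and ind: "right_independent_mod n W us"
    and v: "v \<in> carrier_vec n"
    and notin: "\<And>w d. w \<in> W \<Longrightarrow> d \<in> carrier_vec (length us) \<Longrightarrow> v \<noteq> w + right_lincomb n us d"
  shows "right_independent_mod n W (us @ [v])"
  unfolding right_independent_mod_def
proof (intro ballI impI)
  fix c assume "c \<in> carrier_vec (length (us @ [v]))"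
    and cW: "right_lincomb n (us @ [v]) c \<in> W"
  then have "c \<in> carrier_vec (length us + 1)" by simp
  then obtain d e where c: "d \<in> carrier_vec (length us)" "e \<in> carrier_vec 1" "c = d @\<^sub>v e"
    by (rule carrier_vec_append_cases)
  let ?a = "e $ 0"
  have eq: "right_lincomb n (us @ [v]) c = right_lincomb n us d + right_smult v ?a"
    using right_lincomb_append[of d us e "[v]" n] right_lincomb_singleton[OF v c(2)] c by simp
  have a: "?a = 0"
  proof (rule ccontr)
    assume a: "?a \<noteq> 0"
    let ?b = "inverse ?a"
    let ?w = "right_smult (right_lincomb n us d + right_smult v ?a) ?b"
    have "?w \<in> W" using cW right_subspaceD[OF W] by (simp add: eq)
    moreover have w: "?w = right_lincomb n us (right_smult d ?b) + v"
      using a v c by (simp add: right_smult_add[of _ n] right_lincomb_right_smult right_smult_right_smult)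
    have "v = ?w + right_lincomb n us (right_smult d (- ?b))"
      unfolding w using v c
      by (intro eq_vecI) (auto simp: right_lincomb_right_smult carrier_vecD[OF right_lincomb_carrier])
    ultimately show False using notin[of ?w "right_smult d (- ?b)"] c by auto
  qed
  then have "right_smult v ?a = 0\<^sub>v n" using v by (intro eq_vecI) auto
  then have "d = 0\<^sub>v (length us)"
    using cW ind c unfolding eq by (simp add: right_independent_mod_def)
  then show "c = 0\<^sub>v (length (us @ [v]))"
    using a c by (intro eq_vecI) auto
qed

text \<open>A longest list in \<open>W'\<close> independent modulo \<open>W\<close> works: lengths
  are bounded by \<open>n\<close>, since independence modulo \<open>W\<close> implies ordinary
  independence, and a vector outside the span could be appended.\<close>

lemma exists_basis_mod:
  assumes W: "right_subspace n W" and W': "right_subspace n W'"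
  obtains us where "set us \<subseteq> W'" "right_independent_mod n W us"
    "\<And>x. x \<in> W' \<Longrightarrow> \<exists>w\<in>W. \<exists>d\<in>carrier_vec (length us). x = w + right_lincomb n us d"
proof -
  let ?P = "\<lambda>us. set us \<subseteq> W' \<and> right_independent_mod n W us"
  have "?P []" by (auto simp: right_independent_mod_def)
  moreover have "\<forall>us. ?P us \<longrightarrow> length us < Suc n"
  proof (intro allI impI)
    fix us assume "?P us"
    then have "set us \<subseteq> carrier_vec n" "right_independent_mod n {0\<^sub>v n} us"
      using right_subspaceD[OF W] right_subspaceD[OF W'] by (auto simp: right_independent_mod_def)
    then show "length us < Suc n"
      using length_le_right_dim[OF has_right_dim_carrier_vec] by fastforce
  qed
  ultimately obtain us where us: "?P us" and max: "\<forall>vs. ?P vs \<longrightarrow> length vs \<le> length us"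
    using ex_has_greatest_nat[of ?P "[]" length "Suc n"] by blast
  show thesis
  proof (rule that[of us])
    fix x assume x: "x \<in> W'"
    show "\<exists>w\<in>W. \<exists>d\<in>carrier_vec (length us). x = w + right_lincomb n us d"
    proof (rule ccontr)
      assume "\<not> ?thesis"
      then have "right_independent_mod n W (us @ [x])"
        by (intro right_independent_mod_snoc) (use us x W right_subspaceD(1)[OF W'] in auto)
      then have "length (us @ [x]) \<le> length us"
        by (intro mp[OF spec[OF max]]) (use us x in simp)
      then show False by simp
    qed
  qed (use us in auto)
qed

lemma right_subspace_zero: "right_subspace n {0\<^sub>v n}"
  by (auto simp: right_subspace_def)

text \<open>The quotient of \<open>V'\<close> by \<open>V\<close> is a line spanned by the class of
  \<open>v\<close>. Otherwise a basis of \<open>V\<close> followed by \<open>v\<close> and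
  \<open>y\<close> would be \<open>k + 2\<close> independent vectors in dimension
  \<open>k + 1\<close>.\<close>

lemma right_dim_Suc_coordinate:
  fixes V :: "'a::division_ring vec set"
  assumes V: "has_right_dim n V k" and V': "has_right_dim n V' (Suc k)" "right_subspace n V'"
    and sub: "V \<subseteq> V'" and v: "v \<in> V'" "v \<notin> V" and y: "y \<in> V'"
  shows "\<exists>a. y - right_smult v a \<in> V"
proof (rule ccontr)
  assume neg: "\<not> ?thesis"
  from V obtain bs where bs: "right_basis n V bs" "length bs = k"
    by (auto simp: has_right_dim_def)
  have carr: "v \<in> carrier_vec n" "y \<in> carrier_vec n"
    using v y right_subspaceD(1)[OF V'(2)] by auto
  have in_V: "right_lincomb n bs d \<in> V" if "d \<in> carrier_vec (length bs)" for d
    using right_basisD(3)[OF bs(1)] that by auto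
  have "right_independent_mod n {0\<^sub>v n} (bs @ [v])"
    by (rule right_independent_mod_snoc[OF right_subspace_zero right_basisD(2)[OF bs(1)] carr(1)])
      (use in_V v in auto)
  then have "right_independent_mod n {0\<^sub>v n} ((bs @ [v]) @ [y])"
  proof (rule right_independent_mod_snoc[OF right_subspace_zero _ carr(2)])
    fix w c :: "'a vec" assume w: "w \<in> {0\<^sub>v n}" and "c \<in> carrier_vec (length (bs @ [v]))"
    then have "c \<in> carrier_vec (length bs + 1)" by simp
    then obtain d e where c: "d \<in> carrier_vec (length bs)" "e \<in> carrier_vec 1" "c = d @\<^sub>v e"
      by (rule carrier_vec_append_cases)
    show "y \<noteq> w + right_lincomb n (bs @ [v]) c"
    proof
      assume "y = w + right_lincomb n (bs @ [v]) c"
      then have y_eq: "y = right_lincomb n bs d + right_smult v (e $ 0)"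
        using w right_lincomb_append[of d bs e "[v]" n] right_lincomb_singleton[OF carr(1) c(2)] c carr
        by (simp add: left_zero_vec[of _ n])
      have "y - right_smult v (e $ 0) = right_lincomb n bs d"
        unfolding y_eq using carr
        by (intro eq_vecI) (auto simp: carrier_vecD[OF right_lincomb_carrier])
      then show False using neg in_V[OF c(1)] by metis
    qed
  qed
  moreover have "set bs \<subseteq> V"
    using right_basis_subset[OF bs(1)] .
  ultimately show False
    using length_le_right_dim[OF V'(1), of "(bs @ [v]) @ [y]"] bs(2) sub v y by auto
qed

section \<open>Invariant flags\<close>

text \<open>A triangularizing chain that may stop at a subspace \<open>W\<close> of dimension
  \<open>d\<close>, so that the full chain can be built in stages.\<close>

definition has_invariant_flag ::
  "nat \<Rightarrow> 'a::division_ring mat set \<Rightarrow> 'a vec set \<Rightarrow> nat \<Rightarrow> bool" where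
  "has_invariant_flag n C W d \<longleftrightarrow>
     (\<exists>V. V 0 = {0\<^sub>v n} \<and> V d = W \<and> (\<forall>j<d. V j \<subseteq> V (Suc j)) \<and>
          (\<forall>j\<le>d. right_subspace n (V j) \<and> has_right_dim n (V j) j) \<and>
          (\<forall>A\<in>C. \<forall>j\<le>d. \<forall>v\<in>V j. A *\<^sub>v v \<in> V j))"

lemma triangularizable_iff_flag:
  "triangularizable n C \<longleftrightarrow> has_invariant_flag n C (carrier_vec n) n"
  unfolding triangularizable_def has_invariant_flag_def by blast

lemma mult_mat_vec_zero [simp]: "A \<in> carrier_mat n m \<Longrightarrow> A *\<^sub>v 0\<^sub>v m = 0\<^sub>v n"
  by (intro eq_vecI) (auto simp: scalar_prod_def)

lemma has_invariant_flag_zero: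
  fixes C :: "'a::division_ring mat set"
  assumes "C \<subseteq> carrier_mat n n"
  shows "has_invariant_flag n C {0\<^sub>v n} 0"
  unfolding has_invariant_flag_def
proof (intro exI[of _ "\<lambda>_. {0\<^sub>v n}"] conjI ballI allI impI)
  fix A and v :: "'a vec" assume "A \<in> C" "v \<in> {0\<^sub>v n}"
  then show "A *\<^sub>v v \<in> {0\<^sub>v n}" using assms by auto
qed (auto simp: right_subspace_zero has_right_dim_zero)

section \<open>Induced matrices on quotients\<close>

text \<open>\<open>M\<close> is a matrix of the map that \<open>A\<close> induces on the span of
  \<open>us\<close> modulo \<open>W\<close>; the quotient is again replaced by congruence modulo
  \<open>W\<close>.\<close>

definition induces_mod ::
  "nat \<Rightarrow> 'a::division_ring vec set \<Rightarrow> 'a vec list \<Rightarrow> 'a mat \<Rightarrow> 'a mat \<Rightarrow> bool" where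
  "induces_mod n W us A M \<longleftrightarrow>
     M \<in> carrier_mat (length us) (length us) \<and>
     (\<forall>d\<in>carrier_vec (length us).
        A *\<^sub>v right_lincomb n us d - right_lincomb n us (M *\<^sub>v d) \<in> W)"

lemma induces_modD:
  assumes "induces_mod n W us A M"
  shows "M \<in> carrier_mat (length us) (length us)"
    "d \<in> carrier_vec (length us) \<Longrightarrow>
      A *\<^sub>v right_lincomb n us d - right_lincomb n us (M *\<^sub>v d) \<in> W"
  using assms by (auto simp: induces_mod_def)

lemma induces_mod_mult:
  assumes W: "right_subspace n W" and AW: "\<And>w. w \<in> W \<Longrightarrow> A *\<^sub>v w \<in> W"
    and A: "A \<in> carrier_mat n n" and A': "A' \<in> carrier_mat n n"
    and ind: "induces_mod n W us A M" "induces_mod n W us A' M'"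
  shows "induces_mod n W us (A * A') (M * M')"
  unfolding induces_mod_def
proof (intro conjI ballI)
  note M = induces_modD(1)[OF ind(1)] and M' = induces_modD(1)[OF ind(2)]
  show "M * M' \<in> carrier_mat (length us) (length us)" using M M' by simp
  fix d :: "'a vec" assume d: "d \<in> carrier_vec (length us)"
  let ?l = "right_lincomb n us"
  have M'd: "M' *\<^sub>v d \<in> carrier_vec (length us)" using M' d by simp
  have *: "(A * A') *\<^sub>v ?l d = A *\<^sub>v (A' *\<^sub>v ?l d)" "(M * M') *\<^sub>v d = M *\<^sub>v (M' *\<^sub>v d)"
    using A A' M M' d by (auto intro!: assoc_mult_mat_vec)
  have "A *\<^sub>v (A' *\<^sub>v ?l d - ?l (M' *\<^sub>v d)) = A *\<^sub>v (A' *\<^sub>v ?l d) - A *\<^sub>v ?l (M' *\<^sub>v d)"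
    by (rule mult_minus_distrib_mat_vec[OF A]) (use A' in \<open>auto intro: mult_mat_vec_carrier\<close>)
  \<comment> \<open>The term \<open>A *\<^sub>v ?l (M' *\<^sub>v d)\<close> is subtracted and added:
    the first difference is \<open>A\<close> applied to an element of \<open>W\<close>, the second
    is the congruence for \<open>A\<close>.\<close>
  then have "(A * A') *\<^sub>v ?l d - ?l ((M * M') *\<^sub>v d) =
      A *\<^sub>v (A' *\<^sub>v ?l d - ?l (M' *\<^sub>v d)) + (A *\<^sub>v ?l (M' *\<^sub>v d) - ?l (M *\<^sub>v (M' *\<^sub>v d)))"
    unfolding * using A A' by (intro eq_vecI) (auto simp: carrier_vecD[OF right_lincomb_carrier])
  moreover have "\<dots> \<in> W"
    using right_subspaceD(3)[OF W] AW induces_modD(2)[OF ind(2) d] induces_modD(2)[OF ind(1) M'd] by blast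
  ultimately show "(A * A') *\<^sub>v ?l d - ?l ((M * M') *\<^sub>v d) \<in> W" by simp
qed

lemma induces_mod_one:
  assumes "right_subspace n W"
  shows "induces_mod n W us (1\<^sub>m n) (1\<^sub>m (length us))"
  using right_subspaceD(2)[OF assms]
  by (simp add: induces_mod_def minus_cancel_vec[of _ n])

lemma induces_mod_pow:
  assumes W: "right_subspace n W" and AW: "\<And>w. w \<in> W \<Longrightarrow> A *\<^sub>v w \<in> W"
    and A: "A \<in> carrier_mat n n" and ind: "induces_mod n W us A M"
  shows "induces_mod n W us (A ^\<^sub>m k) (M ^\<^sub>m k)"
proof (induction k)
  case 0
  then show ?case
    using induces_mod_one[OF W] induces_modD(1)[OF ind] A by auto
next
  case (Suc k)
  \<comment> \<open>The power \<open>Suc k\<close> is \<open>A ^\<^sub>m k\<close> times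
    \<open>A\<close>, so multiplicativity asks that the left factor \<open>A ^\<^sub>m k\<close>
    preserve \<open>W\<close>.\<close>
  have AkW: "w \<in> W \<Longrightarrow> (A ^\<^sub>m k) *\<^sub>v w \<in> W" for w
  proof (induction k arbitrary: w)
    case 0
    then show ?case using right_subspaceD(1)[OF W] A by auto
  next
    case (Suc k)
    then have "w \<in> carrier_vec n" using right_subspaceD(1)[OF W] by auto
    then have "(A ^\<^sub>m Suc k) *\<^sub>v w = A ^\<^sub>m k *\<^sub>v (A *\<^sub>v w)"
      using A by (auto intro!: assoc_mult_mat_vec)
    then show ?case using Suc AW by simp
  qed
  from induces_mod_mult[OF W AkW pow_carrier_mat[OF A] A Suc ind]
  show ?case by simp
qed

lemma zero_mat_mult_vec [simp]: "v \<in> carrier_vec m \<Longrightarrow> 0\<^sub>m n m *\<^sub>v v = 0\<^sub>v n"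
  by (intro eq_vecI) (auto simp: scalar_prod_def)

lemma mat_eq_zero_by_mult_vec:
  fixes A :: "'a::semiring_1 mat"
  assumes A: "A \<in> carrier_mat n m" and zero: "\<And>v. v \<in> carrier_vec m \<Longrightarrow> A *\<^sub>v v = 0\<^sub>v n"
  shows "A = 0\<^sub>m n m"
proof (intro eq_matI)
  fix i j assume "i < dim_row (0\<^sub>m n m :: 'a mat)" "j < dim_col (0\<^sub>m n m :: 'a mat)"
  then have ij: "i < n" "j < m" by auto
  then have "(A *\<^sub>v unit_vec m j) $ i = A $$ (i, j)" using A by simp
  then show "A $$ (i, j) = 0\<^sub>m n m $$ (i, j)" using ij zero[of "unit_vec m j"] by simp
qed (use A in auto)

text \<open>\<open>M ^\<^sub>m k\<close> is induced by \<open>N ^\<^sub>m k\<close>, which is zero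
  for suitable \<open>k\<close>; hence the combination with coefficients
  \<open>M ^\<^sub>m k *\<^sub>v d\<close> lies in \<open>W\<close>, and independence modulo
  \<open>W\<close> makes these coefficients vanish.\<close>

lemma induces_mod_nilpotent:
  assumes W: "right_subspace n W" and NW: "\<And>w. w \<in> W \<Longrightarrow> N *\<^sub>v w \<in> W"
    and N: "N \<in> nilpotent_mats n" and ind: "induces_mod n W us N M"
    and us: "right_independent_mod n W us"
  shows "M \<in> nilpotent_mats (length us)"
proof -
  let ?m = "length us"
  from N obtain k where k: "N \<in> carrier_mat n n" "N ^\<^sub>m k = 0\<^sub>m n n" by (auto simp: nilpotent_mats_def)
  note M = induces_modD(1)[OF ind]
  note pow = induces_mod_pow[OF W NW k(1) ind, of k]
  have "M ^\<^sub>m k *\<^sub>v d = 0\<^sub>v ?m" if d: "d \<in> carrier_vec ?m" for d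
  proof -
    let ?x = "right_lincomb n us (M ^\<^sub>m k *\<^sub>v d)"
    have "0\<^sub>v n - ?x \<in> W"
      using induces_modD(2)[OF pow d] k by simp
    then have "0\<^sub>v n - (0\<^sub>v n - ?x) \<in> W"
      using right_subspace_minus[OF W] right_subspaceD(2)[OF W] by blast
    also have "0\<^sub>v n - (0\<^sub>v n - ?x) = ?x"
      by (intro eq_vecI) (auto simp: carrier_vecD[OF right_lincomb_carrier])
    finally show ?thesis
      using us mult_mat_vec_carrier[OF pow_carrier_mat[OF M] d]
      by (auto simp: right_independent_mod_def)
  qed
  then have "M ^\<^sub>m k = 0\<^sub>m ?m ?m"
    using M by (intro mat_eq_zero_by_mult_vec) auto
  then show ?thesis using M by (auto simp: nilpotent_mats_def)
qed

text \<open>Modulo \<open>W\<close>, \<open>T\<close> scales the span of \<open>us\<close> by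
  \<open>c\<close>, and by centrality the matrix \<open>c I\<close> does the same to coordinates.
  Removing the scalar part from \<open>A\<close> and from \<open>M\<close> leaves the action of
  \<open>N\<close>.\<close>

lemma induces_mod_minus_scalar:
  assumes W: "right_subspace n W" and c: "c \<in> ring_center"
    and T: "T \<in> carrier_mat n n" and N: "N \<in> carrier_mat n n" and A_eq: "A = T + N"
    and Tc: "\<And>d. d \<in> carrier_vec (length us) \<Longrightarrow>
      T *\<^sub>v right_lincomb n us d - right_smult (right_lincomb n us d) c \<in> W"
    and ind: "induces_mod n W us A M"
  shows "induces_mod n W us N (M - c \<cdot>\<^sub>m 1\<^sub>m (length us))"
  unfolding induces_mod_def
proof (intro conjI ballI)
  note M = induces_modD(1)[OF ind]
  show "M - c \<cdot>\<^sub>m 1\<^sub>m (length us) \<in> carrier_mat (length us) (length us)"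
    by (intro minus_carrier_mat) auto
  fix d :: "'a vec" assume d: "d \<in> carrier_vec (length us)"
  let ?l = "right_lincomb n us"
  have Md: "M *\<^sub>v d \<in> carrier_vec (length us)" using M d by simp
  have "(M - c \<cdot>\<^sub>m 1\<^sub>m (length us)) *\<^sub>v d = M *\<^sub>v d - right_smult d c"
    using M d c by (simp add: minus_mult_distrib_mat_vec[of _ "length us" "length us"] central_smult_one_mult_vec)
  then have "?l ((M - c \<cdot>\<^sub>m 1\<^sub>m (length us)) *\<^sub>v d) = ?l (M *\<^sub>v d) - right_smult (?l d) c"
    using d Md by (simp add: right_lincomb_diff right_lincomb_right_smult)
  moreover have "A *\<^sub>v ?l d = T *\<^sub>v ?l d + N *\<^sub>v ?l d"
    unfolding A_eq using T N by (intro add_mult_distrib_mat_vec) auto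
  ultimately have "N *\<^sub>v ?l d - ?l ((M - c \<cdot>\<^sub>m 1\<^sub>m (length us)) *\<^sub>v d) =
      (A *\<^sub>v ?l d - ?l (M *\<^sub>v d)) - (T *\<^sub>v ?l d - right_smult (?l d) c)"
    using T N by (intro eq_vecI) (auto simp: carrier_vecD[OF right_lincomb_carrier])
  then show "N *\<^sub>v ?l d - ?l ((M - c \<cdot>\<^sub>m 1\<^sub>m (length us)) *\<^sub>v d) \<in> W"
    using right_subspace_minus[OF W induces_modD(2)[OF ind d] Tc[OF d]] by simp
qed

lemma exists_induces_mod:
  assumes W: "right_subspace n W" and W': "right_subspace n W'" and A: "A \<in> carrier_mat n n"
    and us: "set us \<subseteq> W'"
    and span: "\<And>x. x \<in> W' \<Longrightarrow> \<exists>w\<in>W. \<exists>d\<in>carrier_vec (length us). x = w + right_lincomb n us d"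
    and AW': "\<And>x. x \<in> W' \<Longrightarrow> A *\<^sub>v x \<in> W'"
  shows "\<exists>M. induces_mod n W us A M"
proof -
  let ?m = "length us" and ?l = "right_lincomb n us"
  have us_carr: "set us \<subseteq> carrier_vec n" using us right_subspaceD(1)[OF W'] by auto
  have "\<forall>x\<in>W'. \<exists>d. d \<in> carrier_vec ?m \<and> A *\<^sub>v x - ?l d \<in> W"
  proof
    fix x assume "x \<in> W'"
    then obtain w d where wd: "w \<in> W" "d \<in> carrier_vec ?m" "A *\<^sub>v x = w + ?l d"
      using span[OF AW'] by blast
    have "w \<in> carrier_vec n" using wd right_subspaceD(1)[OF W] by auto
    then have "A *\<^sub>v x - ?l d = w"
      unfolding wd(3) by (intro eq_vecI) (auto simp: carrier_vecD[OF right_lincomb_carrier])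
    then show "\<exists>d. d \<in> carrier_vec ?m \<and> A *\<^sub>v x - ?l d \<in> W" using wd by auto
  qed
  then obtain f where f: "\<And>x. x \<in> W' \<Longrightarrow> f x \<in> carrier_vec ?m"
    "\<And>x. x \<in> W' \<Longrightarrow> A *\<^sub>v x - ?l (f x) \<in> W" by metis
  \<comment> \<open>The choice \<open>f\<close> need not be linear: only its values on the list
    \<open>us\<close> are used, as columns of \<open>M\<close>.\<close>
  define M where "M = mat_of_cols ?m (map f us)"
  let ?g = "\<lambda>x. A *\<^sub>v x - ?l (f x)"
  \<comment> \<open>The errors at the vectors \<open>us\<close> are the columns of a single matrix,
    so the error at any combination of \<open>us\<close> is a combination of elements of
    \<open>W\<close>.\<close>
  have mats: "mat_of_cols n (map ?g us) = A * mat_of_cols n us - mat_of_cols n us * M"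
  proof (intro eq_matI)
    fix i j assume "i < dim_row (A * mat_of_cols n us - mat_of_cols n us * M)"
      "j < dim_col (A * mat_of_cols n us - mat_of_cols n us * M)"
    then have ij: "i < n" "j < ?m" by (auto simp: M_def)
    then have "us ! j \<in> W'" using us by auto
    then have "us ! j \<in> carrier_vec n" "f (us ! j) \<in> carrier_vec ?m"
      using f us_carr ij by auto
    then show "mat_of_cols n (map ?g us) $$ (i, j)
        = (A * mat_of_cols n us - mat_of_cols n us * M) $$ (i, j)"
      using ij A by (simp add: mat_of_cols_index right_lincomb_def M_def)
  qed (use A in \<open>auto simp: M_def\<close>)
  have "induces_mod n W us A M"
    unfolding induces_mod_def
  proof (intro conjI ballI)
    show M: "M \<in> carrier_mat ?m ?m"
      using mat_of_cols_carrier(1)[of ?m "map f us"] by (simp add: M_def)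
    fix d :: "'a vec" assume d: "d \<in> carrier_vec ?m"
    have B: "mat_of_cols n us \<in> carrier_mat n ?m" by simp
    have "A *\<^sub>v ?l d - ?l (M *\<^sub>v d) = right_lincomb n (map ?g us) d"
      unfolding right_lincomb_def[of n "map ?g us"] mats
      unfolding right_lincomb_def
        minus_mult_distrib_mat_vec[OF mult_carrier_mat[OF A B] mult_carrier_mat[OF B M] d]
        assoc_mult_mat_vec[OF A B d] assoc_mult_mat_vec[OF B M d] ..
    moreover have "\<dots> \<in> W"
      by (rule right_lincomb_in_subspace[OF W]) (use f us d in auto)
    ultimately show "A *\<^sub>v ?l d - ?l (M *\<^sub>v d) \<in> W" by simp
  qed
  then show ?thesis ..
qed

section \<open>Lifting flags from quotients\<close>

text \<open>When \<open>us\<close> is a basis of some \<open>W'\<close> modulo \<open>W\<close>,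
  this is the preimage in \<open>W'\<close> of the set \<open>X\<close> of coordinate
  vectors.\<close>

definition lift_mod ::
  "nat \<Rightarrow> 'a::division_ring vec set \<Rightarrow> 'a vec list \<Rightarrow> 'a vec set \<Rightarrow> 'a vec set" where
  "lift_mod n W us X = {w + right_lincomb n us x | w x. w \<in> W \<and> x \<in> X}"

lemma right_subspace_lift_mod:
  assumes W: "right_subspace n W" and X: "right_subspace (length us) X"
  shows "right_subspace n (lift_mod n W us X)"
  unfolding right_subspace_def
proof (intro conjI ballI allI)
  note W_carr = right_subspaceD(1)[OF W] and X_carr = right_subspaceD(1)[OF X]
  show "lift_mod n W us X \<subseteq> carrier_vec n" using W_carr by (auto simp: lift_mod_def)
  have "0\<^sub>v n = 0\<^sub>v n + right_lincomb n us (0\<^sub>v (length us))" by simp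
  then show "0\<^sub>v n \<in> lift_mod n W us X"
    unfolding lift_mod_def using right_subspaceD(2)[OF W] right_subspaceD(2)[OF X] by blast
  fix v assume "v \<in> lift_mod n W us X"
  then obtain w x where v: "v = w + right_lincomb n us x" "w \<in> W" "x \<in> X"
    by (auto simp: lift_mod_def)
  then have carr: "w \<in> carrier_vec n" "x \<in> carrier_vec (length us)" using W_carr X_carr by auto
  show "right_smult v a \<in> lift_mod n W us X" for a
  proof -
    have "right_smult v a = right_smult w a + right_lincomb n us (right_smult x a)"
      using carr by (simp add: v(1) right_smult_add[of _ n] right_lincomb_right_smult)
    then show ?thesis
      unfolding lift_mod_def using v right_subspaceD(4)[OF W] right_subspaceD(4)[OF X] by blast
  qed
  fix v' assume "v' \<in> lift_mod n W us X"
  then obtain w' x' where v': "v' = w' + right_lincomb n us x'" "w' \<in> W" "x' \<in> X"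
    by (auto simp: lift_mod_def)
  then have carr': "w' \<in> carrier_vec n" "x' \<in> carrier_vec (length us)" using W_carr X_carr by auto
  have "v + v' = (w + w') + right_lincomb n us (x + x')"
    using carr carr' by (intro eq_vecI)
      (auto simp: v(1) v'(1) right_lincomb_add carrier_vecD[OF right_lincomb_carrier] algebra_simps)
  then show "v + v' \<in> lift_mod n W us X"
    unfolding lift_mod_def using v v' right_subspaceD(3)[OF W] right_subspaceD(3)[OF X] by blast
qed

text \<open>A basis of \<open>W\<close> followed by the images of a basis of \<open>X\<close> is a
  basis. In a vanishing combination the image part lies in \<open>W\<close>, so its coordinates
  vanish by independence modulo \<open>W\<close>, and then the part in \<open>W\<close> vanishes
  too.\<close>

lemma has_right_dim_lift_mod:
  assumes W: "right_subspace n W" "has_right_dim n W d"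
    and X: "right_subspace (length us) X" "has_right_dim (length us) X e"
    and us: "right_independent_mod n W us"
  shows "has_right_dim n (lift_mod n W us X) (d + e)"
proof -
  from W(2) X(2) obtain ws xs where ws: "right_basis n W ws" "length ws = d"
    and xs: "right_basis (length us) X xs" "length xs = e"
    by (auto simp: has_right_dim_def)
  let ?vs = "map (right_lincomb n us) xs"
  have split: "right_lincomb n (ws @ ?vs) (c @\<^sub>v c') =
      right_lincomb n ws c + right_lincomb n us (right_lincomb (length us) xs c')"
    if "c \<in> carrier_vec d" "c' \<in> carrier_vec e" for c c'
    using that ws xs right_basisD(1)[OF xs(1)]
    by (simp add: right_lincomb_append right_lincomb_right_lincomb)
  have ws_W: "right_lincomb n ws c \<in> W" if "c \<in> carrier_vec d" for c
    using that ws right_basisD(3)[OF ws(1)] by auto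
  have "right_basis n (lift_mod n W us X) (ws @ ?vs)"
    unfolding right_basis_def
  proof (intro conjI ballI impI)
    show "set (ws @ ?vs) \<subseteq> carrier_vec n" using right_basisD(1)[OF ws(1)] by auto
  next
    fix b assume "b \<in> carrier_vec (length (ws @ ?vs))" and zero: "right_lincomb n (ws @ ?vs) b = 0\<^sub>v n"
    then have "b \<in> carrier_vec (d + e)" using ws xs by simp
    then obtain c c' where c: "c \<in> carrier_vec d" "c' \<in> carrier_vec e" "b = c @\<^sub>v c'"
      by (rule carrier_vec_append_cases)
    let ?u = "right_lincomb n us (right_lincomb (length us) xs c')"
    have sum0: "right_lincomb n ws c + ?u = 0\<^sub>v n" using zero split c by simp
    have "?u = (right_lincomb n ws c + ?u) - right_lincomb n ws c"
      by (intro eq_vecI) (auto simp: carrier_vecD[OF right_lincomb_carrier])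
    also have "\<dots> \<in> W"
      unfolding sum0 by (intro right_subspace_minus[OF W(1)] right_subspaceD(2)[OF W(1)] ws_W c)
    finally have "right_lincomb (length us) xs c' = 0\<^sub>v (length us)"
      using us by (auto simp: right_independent_mod_def)
    moreover from this have "right_lincomb n ws c = 0\<^sub>v n" using sum0 by simp
    ultimately have "c = 0\<^sub>v d" "c' = 0\<^sub>v e"
      using right_basisD(2)[OF ws(1)] right_basisD(2)[OF xs(1)] ws xs c
      by (auto simp: right_independent_mod_def)
    then show "b = 0\<^sub>v (length (ws @ ?vs))" using c ws xs by (intro eq_vecI) auto
  next
    show "right_lincomb n (ws @ ?vs) ` carrier_vec (length (ws @ ?vs)) = lift_mod n W us X"
    proof (intro equalityI subsetI)
      fix v assume "v \<in> right_lincomb n (ws @ ?vs) ` carrier_vec (length (ws @ ?vs))"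
      then obtain b where b: "b \<in> carrier_vec (d + e)" "v = right_lincomb n (ws @ ?vs) b"
        using ws xs by auto
      from b(1) obtain c c' where c: "c \<in> carrier_vec d" "c' \<in> carrier_vec e" "b = c @\<^sub>v c'"
        by (rule carrier_vec_append_cases)
      then have "v = right_lincomb n ws c + right_lincomb n us (right_lincomb (length us) xs c')"
        using b split by simp
      moreover have "right_lincomb (length us) xs c' \<in> X"
        using c right_basisD(3)[OF xs(1)] xs(2) by auto
      ultimately show "v \<in> lift_mod n W us X"
        unfolding lift_mod_def using ws_W[OF c(1)] by blast
    next
      fix v assume "v \<in> lift_mod n W us X"
      then obtain w x where v: "v = w + right_lincomb n us x" "w \<in> W" "x \<in> X"
        by (auto simp: lift_mod_def)
      then obtain c c' where c: "c \<in> carrier_vec d" "w = right_lincomb n ws c"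
        "c' \<in> carrier_vec e" "x = right_lincomb (length us) xs c'"
        using right_basisD(3)[OF xs(1)] right_basisD(3)[OF ws(1)] xs(2) ws(2) by auto
      then have "v = right_lincomb n (ws @ ?vs) (c @\<^sub>v c')" using v split by simp
      then show "v \<in> right_lincomb n (ws @ ?vs) ` carrier_vec (length (ws @ ?vs))"
        using c ws xs by (auto intro!: imageI)
    qed
  qed
  then show ?thesis using ws xs by (auto simp: has_right_dim_def)
qed

lemma has_invariant_flagD:
  assumes "has_invariant_flag n C W d"
  shows "right_subspace n W" "has_right_dim n W d" "A \<in> C \<Longrightarrow> w \<in> W \<Longrightarrow> A *\<^sub>v w \<in> W"
  using assms unfolding has_invariant_flag_def by blast+

text \<open>The chain up to \<open>W\<close> is continued by the preimages of a chain in the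
  coordinate space of the quotient. Invariance lifts because \<open>A\<close> acts on coordinates
  through \<open>M\<close> up to an error in \<open>W\<close>.\<close>

lemma has_invariant_flag_extend:
  assumes flag: "has_invariant_flag n S W d" and S: "S \<subseteq> carrier_mat n n"
    and us: "right_independent_mod n W us"
    and ind: "\<And>A. A \<in> S \<Longrightarrow> \<exists>M\<in>C. induces_mod n W us A M"
    and flagC: "has_invariant_flag (length us) C (carrier_vec (length us)) (length us)"
  shows "has_invariant_flag n S (lift_mod n W us (carrier_vec (length us))) (d + length us)"
proof -
  let ?m = "length us"
  note W = has_invariant_flagD[OF flag]
  from flag obtain V where V: "V 0 = {0\<^sub>v n}" "V d = W" "\<forall>j<d. V j \<subseteq> V (Suc j)"
    "\<forall>j\<le>d. right_subspace n (V j) \<and> has_right_dim n (V j) j"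
    "\<forall>A\<in>S. \<forall>j\<le>d. \<forall>v\<in>V j. A *\<^sub>v v \<in> V j"
    by (auto simp: has_invariant_flag_def)
  from flagC obtain X where X: "X 0 = {0\<^sub>v ?m}" "X ?m = carrier_vec ?m"
    "\<forall>j<?m. X j \<subseteq> X (Suc j)"
    "\<forall>j\<le>?m. right_subspace ?m (X j) \<and> has_right_dim ?m (X j) j"
    "\<forall>M\<in>C. \<forall>j\<le>?m. \<forall>v\<in>X j. M *\<^sub>v v \<in> X j"
    by (auto simp: has_invariant_flag_def)
  let ?U = "\<lambda>j. lift_mod n W us (X j)"
  have U0: "?U 0 = W"
    using right_subspaceD(1)[OF W(1)] by (force simp: lift_mod_def X(1))
  have Uinv: "A *\<^sub>v v \<in> ?U j" if A: "A \<in> S" and j: "j \<le> ?m" and v: "v \<in> ?U j" for A j v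
  proof -
    from v obtain w x where wx: "v = w + right_lincomb n us x" "w \<in> W" "x \<in> X j"
      by (auto simp: lift_mod_def)
    have carr: "A \<in> carrier_mat n n" "w \<in> carrier_vec n" "x \<in> carrier_vec ?m"
      using A S wx right_subspaceD(1)[OF W(1)] right_subspaceD(1) X(4) j by blast+
    from ind[OF A] obtain M where M: "M \<in> C" "induces_mod n W us A M" by blast
    let ?r = "A *\<^sub>v right_lincomb n us x - right_lincomb n us (M *\<^sub>v x)"
    have "A *\<^sub>v v = A *\<^sub>v w + A *\<^sub>v right_lincomb n us x"
      unfolding wx(1) using carr by (intro mult_add_distrib_mat_vec) auto
    then have "A *\<^sub>v v = (A *\<^sub>v w + ?r) + right_lincomb n us (M *\<^sub>v x)"
      using carr by (intro eq_vecI) (auto simp: carrier_vecD[OF right_lincomb_carrier])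
    moreover have "A *\<^sub>v w + ?r \<in> W"
      using right_subspaceD(3)[OF W(1)] W(3)[OF A wx(2)] induces_modD(2)[OF M(2) carr(3)] by blast
    ultimately show ?thesis unfolding lift_mod_def using X(5) M(1) j wx(3) by blast
  qed
  \<comment> \<open>The two chains meet at index \<open>d\<close>, where both give
    \<open>W\<close>.\<close>
  define V' where "V' j = (if j \<le> d then V j else ?U (j - d))" for j
  have V'_U: "V' j = ?U (j - d)" if "d \<le> j" for j
    using that V(2) U0 by (cases "j = d") (auto simp: V'_def)
  show ?thesis
    unfolding has_invariant_flag_def
  proof (intro exI[of _ V'] conjI allI impI ballI)
    show "V' 0 = {0\<^sub>v n}" by (simp add: V'_def V)
    show "V' (d + ?m) = lift_mod n W us (carrier_vec ?m)" by (simp add: V'_U X)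
  next
    fix j assume j: "j < d + ?m"
    show "V' j \<subseteq> V' (Suc j)"
    proof (cases "j < d")
      case True
      then show ?thesis using V(3) by (simp add: V'_def)
    next
      case False
      then have "X (j - d) \<subseteq> X (Suc j - d)" using X(3) j False by (simp add: Suc_diff_le)
      then show ?thesis using False by (auto simp: V'_U lift_mod_def)
    qed
  next
    fix j assume j: "j \<le> d + ?m"
    show "right_subspace n (V' j)"
      using V(4) X(4) j by (auto simp: V'_def intro: right_subspace_lift_mod[OF W(1)])
    \<comment> \<open>For \<open>j < d\<close> the truncated difference is 0 and this speaks of
      \<open>W\<close> only; the dimension equals \<open>j\<close> once
      \<open>d \<le> j\<close>.\<close>
    have "has_right_dim n (?U (j - d)) (d + (j - d))"
      by (rule has_right_dim_lift_mod[OF W(1,2) _ _ us]) (use X(4) j in auto)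
    then show "has_right_dim n (V' j) j"
      using V(4) by (auto simp: V'_def)
    fix A v assume "A \<in> S" "v \<in> V' j"
    then show "A *\<^sub>v v \<in> V' j"
      using V(5) Uinv j by (auto simp: V'_def split: if_splits)
  qed
qed

text \<open>Kaplansky's theorem is applied in the dimension of the quotient of \<open>W'\<close> by
  \<open>W\<close>, to the semigroup of all induced matrices. By \<open>decomp\<close> each of them
  is a central scalar plus a nilpotent, and the resulting chain is lifted.\<close>

lemma has_invariant_flag_extend_Kaplansky:
  fixes S :: "'a::division_ring mat set"
  assumes K: "Kaplansky_theorem_over TYPE('a)" and S: "mat_semigroup n S"
    and flag: "has_invariant_flag n S W d"
    and W': "right_subspace n W'" "W \<subset> W'" "\<And>A x. A \<in> S \<Longrightarrow> x \<in> W' \<Longrightarrow> A *\<^sub>v x \<in> W'"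
    and decomp: "\<And>A. A \<in> S \<Longrightarrow> \<exists>c\<in>ring_center. \<exists>T\<in>carrier_mat n n. \<exists>N\<in>nilpotent_mats n.
      A = T + N \<and> (\<forall>w\<in>W. N *\<^sub>v w \<in> W) \<and> (\<forall>x\<in>W'. T *\<^sub>v x - right_smult x c \<in> W)"
  shows "\<exists>e>d. has_invariant_flag n S W' e"
proof -
  note W = has_invariant_flagD[OF flag]
  from S have S_carr: "S \<subseteq> carrier_mat n n" and S_mult: "\<And>A B. A \<in> S \<Longrightarrow> B \<in> S \<Longrightarrow> A * B \<in> S"
    by (auto simp: mat_semigroup_def)
  from exists_basis_mod[OF W(1) W'(1)] obtain us where us: "set us \<subseteq> W'"
    "right_independent_mod n W us"
    and span: "\<And>x. x \<in> W' \<Longrightarrow> \<exists>w\<in>W. \<exists>d\<in>carrier_vec (length us). x = w + right_lincomb n us d"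
    by blast
  let ?m = "length us"
  have lc_W': "right_lincomb n us x \<in> W'" if "x \<in> carrier_vec ?m" for x
    by (rule right_lincomb_in_subspace[OF W'(1) us(1) that])
  define C where "C = {M. \<exists>A\<in>S. induces_mod n W us A M}"
  have "mat_semigroup ?m C"
    unfolding mat_semigroup_def
  proof (intro conjI ballI)
    show "C \<subseteq> carrier_mat ?m ?m" by (auto simp: C_def induces_mod_def)
    fix M M' assume "M \<in> C" "M' \<in> C"
    then obtain A A' where A: "A \<in> S" "A' \<in> S" "induces_mod n W us A M" "induces_mod n W us A' M'"
      by (auto simp: C_def)
    have "induces_mod n W us (A * A') (M * M')"
      by (rule induces_mod_mult[OF W(1) W(3)[OF A(1)] _ _ A(3,4)]) (use A S_carr in auto)
    then show "M * M' \<in> C" using S_mult A by (auto simp: C_def)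
  qed
  moreover have "\<exists>c\<in>ring_center. \<exists>N\<in>nilpotent_mats ?m. M = c \<cdot>\<^sub>m 1\<^sub>m ?m + N" if "M \<in> C" for M
  proof -
    from that obtain A where A: "A \<in> S" "induces_mod n W us A M" by (auto simp: C_def)
    from decomp[OF A(1)] obtain c T N where c: "c \<in> ring_center" and T: "T \<in> carrier_mat n n"
      and N: "N \<in> nilpotent_mats n" and A_eq: "A = T + N" and NW: "\<And>w. w \<in> W \<Longrightarrow> N *\<^sub>v w \<in> W"
      and Tc: "\<And>x. x \<in> W' \<Longrightarrow> T *\<^sub>v x - right_smult x c \<in> W" by blast
    have N_carr: "N \<in> carrier_mat n n" using N by (simp add: nilpotent_mats_def)
    have "induces_mod n W us N (M - c \<cdot>\<^sub>m 1\<^sub>m ?m)"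
      by (rule induces_mod_minus_scalar[OF W(1) c T N_carr A_eq _ A(2)])
        (use Tc lc_W' in auto)
    with NW have "M - c \<cdot>\<^sub>m 1\<^sub>m ?m \<in> nilpotent_mats ?m"
      using induces_mod_nilpotent[OF W(1) _ N _ us(2)] by blast
    moreover have "M = c \<cdot>\<^sub>m 1\<^sub>m ?m + (M - c \<cdot>\<^sub>m 1\<^sub>m ?m)"
      using induces_modD(1)[OF A(2)] by (intro eq_matI) auto
    ultimately show ?thesis using c by blast
  qed
  ultimately have "triangularizable ?m C"
    using K unfolding Kaplansky_theorem_over_def by blast
  then have flagC: "has_invariant_flag ?m C (carrier_vec ?m) ?m"
    by (simp add: triangularizable_iff_flag)
  have ind: "\<exists>M\<in>C. induces_mod n W us A M" if A: "A \<in> S" for A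
  proof -
    have "\<exists>M. induces_mod n W us A M"
      by (rule exists_induces_mod[OF W(1) W'(1) _ us(1) span W'(3)[OF A]]) (use A S_carr in auto)
    then show ?thesis using A by (auto simp: C_def)
  qed
  have lift: "lift_mod n W us (carrier_vec ?m) = W'"
  proof (intro equalityI subsetI)
    fix v assume "v \<in> lift_mod n W us (carrier_vec ?m)"
    then show "v \<in> W'"
      using lc_W' W'(2) right_subspaceD(3)[OF W'(1)] by (auto simp: lift_mod_def)
  next
    fix v assume "v \<in> W'"
    then show "v \<in> lift_mod n W us (carrier_vec ?m)"
      using span unfolding lift_mod_def by blast
  qed
  \<comment> \<open>The strict growth of the dimension comes from \<open>W\<close> being properly
    contained in \<open>W'\<close>.\<close>
  have "?m > 0"
  proof (rule ccontr)
    assume "\<not> ?m > 0"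
    then have "us = []" by simp
    have "x \<in> W" if "x \<in> W'" for x
    proof -
      from span[OF that] \<open>us = []\<close> obtain w where "w \<in> W" "x = w + 0\<^sub>v n" by auto
      then show ?thesis using right_subspaceD(1)[OF W(1)] by auto
    qed
    then show False using W'(2) by auto
  qed
  then show ?thesis
    using has_invariant_flag_extend[OF flag S_carr us(2) ind flagC] lift
    by (intro exI[of _ "d + ?m"]) simp
qed

section \<open>Joint eigenvectors modulo an invariant subspace\<close>

text \<open>The descent below applies the factors \<open>T - \<mu>\<close> one after the other, \<open>\<mu>\<close> running over the
  diagonal of a triangular matrix of \<open>T\<close>.  Each of them shortens the support of the coordinate
  vector, yet multiplies the class of \<open>v\<close> modulo \<open>U\<close> by the nonzero element \<open>l - \<mu>\<close>.\<close>

lemma eigenvalue_mod_central: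
  assumes T: "T \<in> carrier_mat n n" and basis: "triangularizing_basis n T bs"
    and inner: "inner_eigenvalues n T bs \<subseteq> ring_center"
    and U: "right_subspace n U" and TU: "\<And>u. u \<in> U \<Longrightarrow> T *\<^sub>v u \<in> U"
    and v: "v \<in> carrier_vec n" "v \<notin> U" and eig: "T *\<^sub>v v - right_smult v l \<in> U"
  shows "l \<in> ring_center"
proof (rule ccontr)
  assume l: "l \<notin> ring_center"
  from basis obtain M where bs: "right_basis n (carrier_vec n) bs" "length bs = n"
    and M_wrt: "is_matrix_wrt n bs T M" and tri: "upper_triangular M"
    by (auto simp: triangularizing_basis_def)
  from M_wrt have M: "M \<in> carrier_mat n n" by (simp add: is_matrix_wrt_def)
  let ?B = "mat_of_cols n bs"
  have B: "?B \<in> carrier_mat n n" using bs(2) by auto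
  \<comment> \<open>The matrix form of \<open>is_matrix_wrt\<close>: in coordinates with respect to
    \<open>bs\<close>, \<open>T\<close> acts as \<open>M\<close>.\<close>
  have "T * ?B = ?B * M"
  proof (intro mat_col_eqI)
    fix j assume "j < dim_col (?B * M)"
    then have j: "j < n" using M by simp
    then have "bs ! j \<in> carrier_vec n" using right_basisD(1)[OF bs(1)] bs(2) by auto
    then have "col (T * ?B) j = T *\<^sub>v (bs ! j)" using j B bs(2) by (simp add: col_mult2[OF T B j])
    also have "\<dots> = col (?B * M) j"
      using M_wrt j by (simp add: is_matrix_wrt_def right_lincomb_def col_mult2[OF B M j])
    finally show "col (T * ?B) j = col (?B * M) j" .
  qed (use T M bs(2) in auto)
  then have T_lc: "T *\<^sub>v right_lincomb n bs c = right_lincomb n bs (M *\<^sub>v c)"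
    if "c \<in> carrier_vec n" for c
    using that unfolding right_lincomb_def
    by (metis assoc_mult_mat_vec[OF T B that] assoc_mult_mat_vec[OF B M that])
  have diag: "M $$ (p, p) \<in> ring_center" if "p < n" for p
  proof -
    have "M $$ (p, p) \<in> set (diag_mat M)" using that M by (auto simp: diag_mat_def)
    then show ?thesis using inner M_wrt by (auto simp: inner_eigenvalues_def)
  qed
  \<comment> \<open>After \<open>k\<close> factors the last \<open>k\<close> coordinates vanish,
    while the vector is still congruent to a nonzero multiple of \<open>v\<close> modulo
    \<open>U\<close>. At \<open>k = n\<close> this puts a nonzero multiple of \<open>v\<close> into
    \<open>U\<close>.\<close>
  have "\<exists>c\<in>carrier_vec n. (\<forall>i<n. n - k \<le> i \<longrightarrow> c $ i = 0) \<and>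
      (\<exists>a. a \<noteq> 0 \<and> right_lincomb n bs c - right_smult v a \<in> U)" if "k \<le> n" for k
    using that
  proof (induction k)
    case 0
    have "v \<in> right_lincomb n bs ` carrier_vec n"
      using right_basisD(3)[OF bs(1)] bs(2) v(1) by simp
    then obtain c where c: "c \<in> carrier_vec n" "right_lincomb n bs c = v" by blast
    then have "right_lincomb n bs c - right_smult v 1 \<in> U"
      using right_subspaceD(2)[OF U] minus_cancel_vec[OF v(1)] by simp
    then show ?case
      using c(1) zero_neq_one by (intro bexI[of _ c] conjI exI[of _ 1]) auto
  next
    case (Suc k)
    then obtain c a where c: "c \<in> carrier_vec n" "\<And>i. i < n \<Longrightarrow> n - k \<le> i \<Longrightarrow> c $ i = 0"
      and a: "a \<noteq> 0" "right_lincomb n bs c - right_smult v a \<in> U" by auto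
    \<comment> \<open>The last index at which \<open>c\<close> may still be nonzero.\<close>
    define p where "p = n - Suc k"
    have p: "p < n" using Suc.prems by (simp add: p_def)
    define \<mu> where "\<mu> = M $$ (p, p)"
    have \<mu>: "\<mu> * x = x * \<mu>" for x using diag[OF p] by (simp add: \<mu>_def ring_center_def)
    \<comment> \<open>The assumption that \<open>l\<close> is not central separates it from every
      diagonal entry.\<close>
    have "\<mu> \<noteq> l" using diag[OF p] l by (auto simp: \<mu>_def)
    define c' where "c' = M *\<^sub>v c - right_smult c \<mu>"
    have c'_carr: "c' \<in> carrier_vec n" using M c by (simp add: c'_def)
    have Mc: "M *\<^sub>v c \<in> carrier_vec n" using M c by simp
    \<comment> \<open>In a row \<open>i \<ge> p\<close> triangularity and the zeros of
      \<open>c\<close> leave only the term at \<open>p\<close>. At \<open>i = p\<close> it cancels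
      because \<open>\<mu>\<close> is central; below, both terms are zero.\<close>
    have "c' $ i = 0" if i: "i < n" "p \<le> i" for i
    proof -
      have "(M *\<^sub>v c) $ i = (\<Sum>j = 0..<n. M $$ (i, j) * c $ j)"
        using M c i by (simp add: scalar_prod_def)
      also have "\<dots> = (\<Sum>j = 0..<n. if j = p then M $$ (i, p) * c $ p else 0)"
      proof (rule sum.cong[OF refl])
        fix j assume j: "j \<in> {0..<n}"
        have "M $$ (i, j) = 0" if "j < p"
          using upper_triangularD[OF tri, of j i] that i M by simp
        moreover have "c $ j = 0" if "p < j"
          using c(2)[of j] that j by (simp add: p_def)
        ultimately show "M $$ (i, j) * c $ j = (if j = p then M $$ (i, p) * c $ p else 0)"
          by (cases j p rule: linorder_cases) auto
      qed
      also have "\<dots> = M $$ (i, p) * c $ p" using p by simp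
      finally have "c' $ i = M $$ (i, p) * c $ p - c $ i * \<mu>"
        using i c M by (simp add: c'_def)
      also have "\<dots> = 0"
      proof (cases "i = p")
        case True
        then show ?thesis using \<mu> by (simp add: \<mu>_def)
      next
        case False
        then have "p < i" using i by simp
        then have "M $$ (i, p) = 0" "c $ i = 0"
          using upper_triangularD[OF tri, of p i] i M c(2)[of i] by (auto simp: p_def)
        then show ?thesis by simp
      qed
      finally show ?thesis .
    qed
    \<comment> \<open>Modulo \<open>U\<close>, \<open>T\<close> sends \<open>v a\<close> to
      \<open>v l a\<close>, and \<open>v a \<mu> = v \<mu> a\<close> by centrality, so the new
      multiplier is \<open>(l - \<mu>) a\<close>.\<close>
    moreover have "right_lincomb n bs c' - right_smult v ((l - \<mu>) * a) \<in> U"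
    proof -
      let ?x = "right_lincomb n bs c"
      let ?u = "?x - right_smult v a" and ?z = "T *\<^sub>v v - right_smult v l"
      have u: "?u \<in> U" by (rule a)
      have x_eq: "?x = right_smult v a + ?u"
        using v(1) by (intro eq_vecI) (auto simp: carrier_vecD[OF right_lincomb_carrier])
      have "T *\<^sub>v ?x = T *\<^sub>v right_smult v a + T *\<^sub>v ?u"
        by (subst x_eq, rule mult_add_distrib_mat_vec[OF T]) (use v in auto)
      then have Tx: "T *\<^sub>v ?x = right_smult (T *\<^sub>v v) a + T *\<^sub>v ?u"
        using mult_mat_vec_right_smult[OF T v(1)] by simp
      have "right_lincomb n bs c' = T *\<^sub>v ?x - right_smult ?x \<mu>"
        using c Mc bs(2) by (simp add: c'_def T_lc right_lincomb_diff right_lincomb_right_smult)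
      also have "\<dots> - right_smult v ((l - \<mu>) * a) =
          right_smult ?z a + (T *\<^sub>v ?u - right_smult ?u \<mu>)"
        unfolding Tx using T v(1)
        by (intro eq_vecI) (auto simp: carrier_vecD[OF right_lincomb_carrier] algebra_simps \<mu>)
      also have "\<dots> \<in> U"
        using right_subspaceD(3,4)[OF U] right_subspace_minus[OF U] TU u eig by simp
      finally show ?thesis .
    qed
    moreover have "(l - \<mu>) * a \<noteq> 0" using \<open>\<mu> \<noteq> l\<close> a by simp
    ultimately show ?case using c'_carr unfolding p_def by blast
  qed
  from this[of n] obtain c a where c: "c \<in> carrier_vec n" "\<And>i. i < n \<Longrightarrow> c $ i = 0"
    and a: "a \<noteq> 0" "right_lincomb n bs c - right_smult v a \<in> U" by auto
  have "c = 0\<^sub>v (length bs)" using c bs(2) by (intro eq_vecI) auto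
  then have "0\<^sub>v n - right_smult v a \<in> U" using a by simp
  then have "0\<^sub>v n - (0\<^sub>v n - right_smult v a) \<in> U"
    using right_subspace_minus[OF U] right_subspaceD(2)[OF U] by blast
  also have "0\<^sub>v n - (0\<^sub>v n - right_smult v a) = right_smult v a"
    using v(1) by (intro eq_vecI) auto
  finally show False using right_subspace_smult_cancel[OF U _ a(1)] v(2) by blast
qed

text \<open>Induction on the codimension \<open>n - d\<close>. Invariance of \<open>W\<close> under
  \<open>Ts\<close> and under the whole commutant is carried along, since the next subspace
  \<open>W'\<close> inherits exactly these properties from it.\<close>

lemma triangularizable_if_partial_flag:
  fixes Ts S :: "'a::division_ring mat set"
  assumes K: "Kaplansky_theorem_over TYPE('a)"
    and Ts: "Ts \<subseteq> carrier_mat n n" "triangularizable n Ts"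
    and inner: "has_inner_eigenvalues_in n Ts ring_center"
    and S: "mat_semigroup n S"
    and decomp: "\<And>A. A \<in> S \<Longrightarrow> \<exists>T\<in>Ts. \<exists>N\<in>commutant n Ts \<inter> nilpotent_mats n. A = T + N"
    and flag: "has_invariant_flag n S W d"
    and TsW: "\<And>T w. T \<in> Ts \<Longrightarrow> w \<in> W \<Longrightarrow> T *\<^sub>v w \<in> W"
    and CW: "\<And>N w. N \<in> commutant n Ts \<Longrightarrow> w \<in> W \<Longrightarrow> N *\<^sub>v w \<in> W"
  shows "triangularizable n S"
  using flag TsW CW
proof (induction "n - d" arbitrary: W d rule: less_induct)
  case less
  note W = has_invariant_flagD[OF less.prems(1)]
  note W_carr = right_subspaceD(1)[OF W(1)]
  show ?case
  proof (cases "W = carrier_vec n")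
    case True
    have "d = n"
      using has_right_dim_mono[OF W(2) has_right_dim_carrier_vec W_carr]
        has_right_dim_mono[OF has_right_dim_carrier_vec W(2)] True by simp
    then show ?thesis using less.prems(1) True by (simp add: triangularizable_iff_flag)
  next
    case False
    from Ts(2) obtain V where V: "V 0 = {0\<^sub>v n}" "V n = carrier_vec n"
      "\<forall>j<n. V j \<subseteq> V (Suc j)" "\<forall>j\<le>n. right_subspace n (V j) \<and> has_right_dim n (V j) j"
      "\<forall>A\<in>Ts. \<forall>j\<le>n. \<forall>v\<in>V j. A *\<^sub>v v \<in> V j"
      by (auto simp: triangularizable_def)
    \<comment> \<open>The predecessor of \<open>V j\<close> lies in \<open>W\<close> and has
      codimension one in \<open>V j\<close>, so every \<open>T\<close> in \<open>Ts\<close>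
      multiplies \<open>v\<close> by a scalar modulo \<open>W\<close>.\<close>
    define j where "j = (LEAST j. \<not> V j \<subseteq> W)"
    have "\<not> V n \<subseteq> W" using V(2) False W_carr by auto
    then have j: "\<not> V j \<subseteq> W" "j \<le> n"
      unfolding j_def by (rule LeastI, rule Least_le)
    have j_least: "V i \<subseteq> W" if "i < j" for i
      using not_less_Least[OF that[unfolded j_def]] by simp
    have "j \<noteq> 0" using j(1) V(1) right_subspaceD(2)[OF W(1)] by (intro notI) auto
    then obtain p where p: "j = Suc p" by (cases j) auto
    from j(1) obtain v where v: "v \<in> V j" "v \<notin> W" by auto
    have VpW: "V p \<subseteq> W" using j_least p by simp
    have v_carr: "v \<in> carrier_vec n" using v V(4) j(2) right_subspaceD(1) by blast
    have "\<exists>l\<in>ring_center. T *\<^sub>v v - right_smult v l \<in> W" if T: "T \<in> Ts" for T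
    proof -
      have "T *\<^sub>v v \<in> V (Suc p)" using V(5) T j(2) v(1) p by blast
      moreover have "v \<notin> V p" using v VpW by auto
      ultimately obtain l where "T *\<^sub>v v - right_smult v l \<in> V p"
        using right_dim_Suc_coordinate[of n "V p" p "V (Suc p)" v "T *\<^sub>v v"] V(3,4) j(2) p v(1)
        by auto
      then have l: "T *\<^sub>v v - right_smult v l \<in> W" using VpW by auto
      from inner T obtain bs where "triangularizing_basis n T bs"
        "inner_eigenvalues n T bs \<subseteq> ring_center"
        by (auto simp: has_inner_eigenvalues_in_def)
      then have "l \<in> ring_center"
        using eigenvalue_mod_central[OF _ _ _ W(1) _ v_carr v(2) l] Ts(1) T less.prems(2) by blast
      then show ?thesis using l by blast
    qed
    then obtain lam where lam: "\<And>T. T \<in> Ts \<Longrightarrow> lam T \<in> ring_center"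
      "\<And>T. T \<in> Ts \<Longrightarrow> T *\<^sub>v v - right_smult v (lam T) \<in> W" by metis
    define W' where "W' = {x \<in> carrier_vec n. \<forall>T\<in>Ts. T *\<^sub>v x - right_smult x (lam T) \<in> W}"
    have W'D: "x \<in> carrier_vec n" "T \<in> Ts \<Longrightarrow> T *\<^sub>v x - right_smult x (lam T) \<in> W"
      if "x \<in> W'" for x T using that by (auto simp: W'_def)
    have W'_sub: "right_subspace n W'"
      unfolding right_subspace_def
    proof (intro conjI ballI allI)
      show "W' \<subseteq> carrier_vec n" by (auto simp: W'_def)
      show "0\<^sub>v n \<in> W'"
        using right_subspaceD(2)[OF W(1)] less.prems(2) right_subspace_minus[OF W(1)]
        by (simp add: W'_def)
      fix x assume x: "x \<in> W'"
      show "right_smult x a \<in> W'" for a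
        unfolding W'_def
      proof (intro CollectI conjI ballI)
        show "right_smult x a \<in> carrier_vec n" using W'D(1)[OF x] by simp
        fix T assume T: "T \<in> Ts"
        \<comment> \<open>Centrality of \<open>lam T\<close> lets it pass the scalar
          \<open>a\<close>; for a noncentral eigenvalue this set need not be a right
          subspace.\<close>
        have "T *\<^sub>v right_smult x a - right_smult (right_smult x a) (lam T)
            = right_smult (T *\<^sub>v x - right_smult x (lam T)) a"
          using T Ts(1) W'D(1)[OF x] lam(1)[OF T]
          by (subst mult_mat_vec_right_smult[of _ n n])
            (auto intro!: eq_vecI simp: ring_center_def algebra_simps)
        then show "T *\<^sub>v right_smult x a - right_smult (right_smult x a) (lam T) \<in> W"
          using right_subspaceD(4)[OF W(1) W'D(2)[OF x T]] by simp
      qed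
      fix y assume y: "y \<in> W'"
      show "x + y \<in> W'"
        unfolding W'_def
      proof (intro CollectI conjI ballI)
        show "x + y \<in> carrier_vec n" using W'D(1)[OF x] W'D(1)[OF y] by simp
        fix T assume T: "T \<in> Ts"
        have "T *\<^sub>v (x + y) - right_smult (x + y) (lam T)
            = (T *\<^sub>v x - right_smult x (lam T)) + (T *\<^sub>v y - right_smult y (lam T))"
          using T Ts(1) W'D(1)[OF x] W'D(1)[OF y]
          by (subst mult_add_distrib_mat_vec[of _ n n])
            (auto intro!: eq_vecI simp: algebra_simps)
        then show "T *\<^sub>v (x + y) - right_smult (x + y) (lam T) \<in> W"
          using right_subspaceD(3)[OF W(1) W'D(2)[OF x T] W'D(2)[OF y T]] by simp
      qed
    qed
    have WW': "W \<subset> W'"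
    proof
      show "W \<subseteq> W'"
        using W_carr less.prems(2) right_subspace_minus[OF W(1)] right_subspaceD(4)[OF W(1)]
        by (auto simp: W'_def)
      have "v \<in> W'" using v_carr lam(2) by (simp add: W'_def)
      then show "W \<noteq> W'" using v(2) by auto
    qed
    have TsW': "T *\<^sub>v x \<in> W'" if T: "T \<in> Ts" and x: "x \<in> W'" for T x
    proof -
      have "T *\<^sub>v x = right_smult x (lam T) + (T *\<^sub>v x - right_smult x (lam T))"
        using T Ts(1) W'D(1)[OF x] by (intro eq_vecI) auto
      then show ?thesis
        using right_subspaceD(3,4)[OF W'_sub] x W'D(2)[OF x T] WW' by (metis psubsetD)
    qed
    have CW': "N *\<^sub>v x \<in> W'" if N: "N \<in> commutant n Ts" and x: "x \<in> W'" for N x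
      unfolding W'_def
    proof (intro CollectI conjI ballI)
      have N_carr: "N \<in> carrier_mat n n" using N by (simp add: commutant_def)
      note x_carr = W'D(1)[OF x]
      show "N *\<^sub>v x \<in> carrier_vec n" using N_carr x_carr by simp
      fix T assume T: "T \<in> Ts"
      have T_carr: "T \<in> carrier_mat n n" using T Ts(1) by auto
      \<comment> \<open>Since \<open>N\<close> commutes with \<open>T\<close>, subtracting the
        scalar \<open>lam T\<close> commutes with \<open>N\<close> as well, and \<open>N\<close>
        preserves \<open>W\<close>.\<close>
      have "T *\<^sub>v (N *\<^sub>v x) = N *\<^sub>v (T *\<^sub>v x)"
        using N T by (simp add: commutant_def assoc_mult_mat_vec[OF T_carr N_carr x_carr, symmetric]
          assoc_mult_mat_vec[OF N_carr T_carr x_carr, symmetric])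
      then have "T *\<^sub>v (N *\<^sub>v x) - right_smult (N *\<^sub>v x) (lam T)
          = N *\<^sub>v (T *\<^sub>v x - right_smult x (lam T))"
        using T_carr N_carr x_carr
        by (simp add: mult_minus_distrib_mat_vec[OF N_carr] mult_mat_vec_right_smult[OF N_carr x_carr])
      then show "T *\<^sub>v (N *\<^sub>v x) - right_smult (N *\<^sub>v x) (lam T) \<in> W"
        using less.prems(3)[OF N W'D(2)[OF x T]] by simp
    qed
    have SW': "A *\<^sub>v x \<in> W'" if A: "A \<in> S" and x: "x \<in> W'" for A x
    proof -
      from decomp[OF A] obtain T N where TN: "T \<in> Ts" "N \<in> commutant n Ts" "A = T + N" by blast
      have "A *\<^sub>v x = T *\<^sub>v x + N *\<^sub>v x"
        unfolding TN(3) using TN Ts(1) W'D(1)[OF x]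
        by (intro add_mult_distrib_mat_vec) (auto simp: commutant_def)
      then show ?thesis
        using right_subspaceD(3)[OF W'_sub TsW'[OF TN(1) x] CW'[OF TN(2) x]] by simp
    qed
    have "\<exists>e>d. has_invariant_flag n S W' e"
    proof (rule has_invariant_flag_extend_Kaplansky[OF K S less.prems(1) W'_sub WW' SW'])
      fix A assume "A \<in> S"
      from decomp[OF this] obtain T N where TN: "T \<in> Ts" "N \<in> commutant n Ts"
        "N \<in> nilpotent_mats n" "A = T + N" by blast
      \<comment> \<open>The scalar is \<open>lam T\<close>, for the summand \<open>T\<close> of the
        given decomposition.\<close>
      then show "\<exists>c\<in>ring_center. \<exists>T\<in>carrier_mat n n. \<exists>N\<in>nilpotent_mats n.
          A = T + N \<and> (\<forall>w\<in>W. N *\<^sub>v w \<in> W) \<and> (\<forall>x\<in>W'. T *\<^sub>v x - right_smult x c \<in> W)"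
        using lam(1) Ts(1) less.prems(3) W'D(2) by blast
    qed
    then obtain e where e: "e > d" "has_invariant_flag n S W' e" by blast
    \<comment> \<open>Together with \<open>d < e\<close> this gives \<open>d < n\<close>, so the
      truncated codimension really decreases.\<close>
    have "e \<le> n"
      using has_right_dim_mono[OF has_invariant_flagD(2)[OF e(2)] has_right_dim_carrier_vec]
        right_subspaceD(1)[OF W'_sub] by simp
    then have "n - e < n - d" using e(1) by simp
    then show ?thesis using less.hyps e(2) TsW' CW' by blast
  qed
qed

theorem theorem2p4:
  fixes n :: nat and Ts S :: "'a::division_ring mat set"
  assumes "Kaplansky_theorem_over TYPE('a)"
    and "Ts \<subseteq> carrier_mat n n"
    and "triangularizable n Ts"
    and "has_inner_eigenvalues_in n Ts ring_center"
    and "mat_semigroup n S"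
    and "\<And>A. A \<in> S \<Longrightarrow> \<exists>T\<in>Ts. \<exists>N\<in>commutant n Ts \<inter> nilpotent_mats n. A = T + N"
  shows "triangularizable n S"
proof -
  have "S \<subseteq> carrier_mat n n" using assms(5) by (simp add: mat_semigroup_def)
  \<comment> \<open>The filtration starts at the zero subspace, which every matrix
    preserves.\<close>
  then have "has_invariant_flag n S {0\<^sub>v n} 0" by (rule has_invariant_flag_zero)
  moreover have "T *\<^sub>v w \<in> {0\<^sub>v n}" if "T \<in> Ts" "w \<in> {0\<^sub>v n}" for T w
    using that assms(2) by auto
  moreover have "N *\<^sub>v w \<in> {0\<^sub>v n}" if "N \<in> commutant n Ts" "w \<in> {0\<^sub>v n}" for N w
    using that by (auto simp: commutant_def)
  ultimately show ?thesis
    using triangularizable_if_partial_flag[OF assms(1-5)] assms(6) by blast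
qed

end
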